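(* (Family $(1/2,-,1)$, Painlevé III($\tilde D_7$).) Let $\theta_\infty\in\mathbb{C}$, and let $p,q$ be holomorphic functions of $t$ on a connected open set $U\subset\mathbb{C}^*$ with $q$ avoiding $0$. Put $w=\frac12(-tq^2-\theta_\infty q+2p)$, $h=\frac{t^2q^4-\theta_\infty^2q^2-4ptq^2-4q+4p^2}{4q^2}$, $$A_0=\begin{pmatrix}w&\frac{w^2}{q}\\-q&-w\end{pmatrix},\quad A_1=\begin{pmatrix}\frac{\theta_\infty}2&h\\1&-\frac{\theta_\infty}2\end{pmatrix},\quad A_2=\begin{pmatrix}\frac t2&0\\0&-\frac t2\end{pmatrix},$$ $$B=z\begin{pmatrix}\frac12&0\\0&-\frac12\end{pmatrix}+\begin{pmatrix}\frac q2+\frac{\theta_\infty}{2t}&\frac ht\\\frac1t&-\frac q2-\frac{\theta_\infty}{2t}\end{pmatrix}.$$ Then the operators $\frac{d}{dz}+\frac1{z^2}A_0+\frac1zA_1+A_2$ and $\frac{d}{dt}+B$ commute if and only if $$\frac{dq}{dt}=\frac{2p}t,\qquad\frac{dp}{dt}=\frac{2p^2}{tq}+\frac{tq^3}2+\frac12(\theta_\infty+1)q^2-\frac1t .$$ This system is the Hamiltonian system $\frac{dq}{dt}=-q^2\frac{\partial H}{\partial p}$, $\frac{dp}{dt}=q^2\frac{\partial H}{\partial q}$ with $$H=-\frac{p^2}{q^2t}+\frac{q^2t}4+\frac12q(\theta_\infty+1)+\frac1{qt},$$ and, with $p=\frac t2q'$, it is equivalent to $$q''=\frac{(q')^2}q-\frac{q'}t+\frac{(\theta_\infty+1)q^2}t+q^3-\frac2{t^2}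 .$$
   Context: Operators act on vector-valued functions of $(z,t)$; $\frac{d}{dz},\frac{d}{dt}$ are the partial derivatives. Two operators $\frac{d}{dz}+A$ and $\frac{d}{dt}+B$ with matrix functions $A(z,t),B(z,t)$ commute iff $\frac{\partial A}{\partial t}=\frac{\partial B}{\partial z}+AB-BA$ identically in $z,t$. In the Hamiltonian equations $H=H(p,q,t)$ with partial derivatives in the independent variables $p,q,t$; $'$ denotes $\frac{d}{dt}$. (This commutation is the isomonodromy condition for the family of connections.) *)

theory Defs
  imports "HOL-Analysis.Analysis"
begin

definition partial_z ::
    "(complex \<Rightarrow> complex \<Rightarrow> complex ^ 'n) \<Rightarrow> complex \<Rightarrow> complex \<Rightarrow> complex ^ 'n"
  where "partial_z f z t = (\<chi> i. deriv (\<lambda>s. f s t $ i) z)"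

definition partial_t ::
    "(complex \<Rightarrow> complex \<Rightarrow> complex ^ 'n) \<Rightarrow> complex \<Rightarrow> complex \<Rightarrow> complex ^ 'n"
  where "partial_t f z t = (\<chi> i. deriv (\<lambda>s. f z s $ i) t)"

text \<open>Joint holomorphy: at every point of the (open) domain each component has a total
  derivative that is complex linear.\<close>

definition holomorphic2_on ::
    "(complex \<Rightarrow> complex \<Rightarrow> complex ^ 'n) \<Rightarrow> (complex \<times> complex) set \<Rightarrow> bool"
  where "holomorphic2_on f D \<longleftrightarrow>
    (\<forall>x\<in>D. \<forall>i. \<exists>a b. ((\<lambda>y. f (fst y) (snd y) $ i)
        has_derivative (\<lambda>v. a * fst v + b * snd v)) (at x))"

definition operator_z ::
    "(complex \<Rightarrow> complex \<Rightarrow> complex ^ 'n ^ 'n) \<Rightarrow>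
     (complex \<Rightarrow> complex \<Rightarrow> complex ^ 'n) \<Rightarrow> complex \<Rightarrow> complex \<Rightarrow> complex ^ 'n"
  where "operator_z A f z t = partial_z f z t + A z t *v f z t"

definition operator_t ::
    "(complex \<Rightarrow> complex \<Rightarrow> complex ^ 'n ^ 'n) \<Rightarrow>
     (complex \<Rightarrow> complex \<Rightarrow> complex ^ 'n) \<Rightarrow> complex \<Rightarrow> complex \<Rightarrow> complex ^ 'n"
  where "operator_t B f z t = partial_t f z t + B z t *v f z t"

text \<open>The operators \<open>d/dz + A\<close> and \<open>d/dt + B\<close> commute on the holomorphic vector-valued
  functions on \<open>D\<close>.  For holomorphic \<open>A\<close>, \<open>B\<close> and open \<open>D\<close> this is the zero-curvature equation
  \<open>A\<^sub>t = B\<^sub>z + AB - BA\<close> on \<open>D\<close>.\<close>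

definition operators_commute_on ::
    "(complex \<times> complex) set \<Rightarrow> (complex \<Rightarrow> complex \<Rightarrow> complex ^ 'n ^ 'n) \<Rightarrow>
     (complex \<Rightarrow> complex \<Rightarrow> complex ^ 'n ^ 'n) \<Rightarrow> bool"
  where "operators_commute_on D A B \<longleftrightarrow>
    (\<forall>f. holomorphic2_on f D \<longrightarrow>
      (\<forall>(z, t)\<in>D. operator_z A (operator_t B f) z t = operator_t B (operator_z A f) z t))"

definition mat_scale :: "complex \<Rightarrow> complex ^ 'n ^ 'm \<Rightarrow> complex ^ 'n ^ 'm"  (infixr \<open>*\<^sub>m\<close> 75)
  where "c *\<^sub>m M = (\<chi> i j. c * M $ i $ j)"

definition mat22 :: "complex \<Rightarrow> complex \<Rightarrow> complex \<Rightarrow> complex \<Rightarrow> complex ^ 2 ^ 2"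
  where "mat22 a b c d = vector [vector [a, b], vector [c, d]]"

text \<open>Throughout, \<open>\<theta>\<close> is the parameter \<open>\<theta>\<^sub>\<infinity>\<close>.\<close>

definition w_fun :: "complex \<Rightarrow> complex \<Rightarrow> complex \<Rightarrow> complex \<Rightarrow> complex"
  where "w_fun \<theta> p q t = (1 / 2) * (- t * q ^ 2 - \<theta> * q + 2 * p)"

definition h_fun :: "complex \<Rightarrow> complex \<Rightarrow> complex \<Rightarrow> complex \<Rightarrow> complex"
  where "h_fun \<theta> p q t =
    (t ^ 2 * q ^ 4 - \<theta> ^ 2 * q ^ 2 - 4 * p * t * q ^ 2 - 4 * q + 4 * p ^ 2) / (4 * q ^ 2)"

definition A0 :: "complex \<Rightarrow> complex \<Rightarrow> complex \<Rightarrow> complex \<Rightarrow> complex ^ 2 ^ 2"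
  where "A0 \<theta> p q t =
    mat22 (w_fun \<theta> p q t) ((w_fun \<theta> p q t) ^ 2 / q)
          (- q)           (- w_fun \<theta> p q t)"

definition A1 :: "complex \<Rightarrow> complex \<Rightarrow> complex \<Rightarrow> complex \<Rightarrow> complex ^ 2 ^ 2"
  where "A1 \<theta> p q t =
    mat22 (\<theta> / 2) (h_fun \<theta> p q t)
          1       (- \<theta> / 2)"

definition A2 :: "complex \<Rightarrow> complex ^ 2 ^ 2"
  where "A2 t = mat22 (t / 2) 0 0 (- t / 2)"

definition B_lin :: "complex ^ 2 ^ 2"
  where "B_lin = mat22 (1 / 2) 0 0 (- 1 / 2)"

definition B_const :: "complex \<Rightarrow> complex \<Rightarrow> complex \<Rightarrow> complex \<Rightarrow> complex ^ 2 ^ 2"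
  where "B_const \<theta> p q t =
    mat22 (q / 2 + \<theta> / (2 * t)) (h_fun \<theta> p q t / t)
          (1 / t)               (- q / 2 - \<theta> / (2 * t))"

definition conn_A ::
    "complex \<Rightarrow> (complex \<Rightarrow> complex) \<Rightarrow> (complex \<Rightarrow> complex) \<Rightarrow> complex \<Rightarrow> complex \<Rightarrow> complex ^ 2 ^ 2"
  where "conn_A \<theta> p q z t =
    (1 / z ^ 2) *\<^sub>m A0 \<theta> (p t) (q t) t + (1 / z) *\<^sub>m A1 \<theta> (p t) (q t) t + A2 t"

definition conn_B ::
    "complex \<Rightarrow> (complex \<Rightarrow> complex) \<Rightarrow> (complex \<Rightarrow> complex) \<Rightarrow> complex \<Rightarrow> complex \<Rightarrow> complex ^ 2 ^ 2"
  where "conn_B \<theta> p q z t = z *\<^sub>m B_lin + B_const \<theta> (p t) (q t) t"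

definition pq_system :: "complex \<Rightarrow> complex set \<Rightarrow> (complex \<Rightarrow> complex) \<Rightarrow> (complex \<Rightarrow> complex) \<Rightarrow> bool"
  where "pq_system \<theta> U p q \<longleftrightarrow>
    (\<forall>t\<in>U. deriv q t = 2 * p t / t \<and>
           deriv p t = 2 * (p t) ^ 2 / (t * q t) + t * (q t) ^ 3 / 2
                       + (1 / 2) * (\<theta> + 1) * (q t) ^ 2 - 1 / t)"

definition Ham :: "complex \<Rightarrow> complex \<Rightarrow> complex \<Rightarrow> complex \<Rightarrow> complex"
  where "Ham \<theta> p q t =
    - (p ^ 2 / (q ^ 2 * t)) + q ^ 2 * t / 4 + (1 / 2) * q * (\<theta> + 1) + 1 / (q * t)"

definition Ham_p :: "complex \<Rightarrow> complex \<Rightarrow> complex \<Rightarrow> complex \<Rightarrow> complex"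
  where "Ham_p \<theta> p q t = deriv (\<lambda>x. Ham \<theta> x q t) p"

definition Ham_q :: "complex \<Rightarrow> complex \<Rightarrow> complex \<Rightarrow> complex \<Rightarrow> complex"
  where "Ham_q \<theta> p q t = deriv (\<lambda>x. Ham \<theta> p x t) q"

definition hamiltonian_system ::
    "complex \<Rightarrow> complex set \<Rightarrow> (complex \<Rightarrow> complex) \<Rightarrow> (complex \<Rightarrow> complex) \<Rightarrow> bool"
  where "hamiltonian_system \<theta> U p q \<longleftrightarrow>
    (\<forall>t\<in>U. deriv q t = - ((q t) ^ 2) * Ham_p \<theta> (p t) (q t) t \<and>
           deriv p t = (q t) ^ 2 * Ham_q \<theta> (p t) (q t) t)"

definition painleve_III_D7 :: "complex \<Rightarrow> complex set \<Rightarrow> (complex \<Rightarrow> complex) \<Rightarrow> bool"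
  where "painleve_III_D7 \<theta> U q \<longleftrightarrow>
    (\<forall>t\<in>U. deriv (deriv q) t =
      (deriv q t) ^ 2 / q t - deriv q t / t + (\<theta> + 1) * (q t) ^ 2 / t + (q t) ^ 3 - 2 / t ^ 2)"

end

theory Submission
  imports Defs "HOL-Complex_Analysis.Cauchy_Integral_Formula"
begin

text \<open>Since mixed partial derivatives agree, the commutator of the two operators is multiplication by
  the matrix \<open>B\<^sub>z - A\<^sub>t + AB - BA\<close>, so testing on constant functions gives the zero-curvature
  equation.  As \<open>h = (w\<^sup>2 + \<theta>qw - q) / q\<^sup>2\<close>, its diagonal and lower left entries amount to
  \<open>w' = (w\<^sup>2/q + qh)/t\<close> and \<open>q' = q\<^sup>2 + \<theta>q/t + 2w/t\<close>, which already imply the upper right entry;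
  eliminating \<open>w\<close> leaves the system for \<open>p\<close> and \<open>q\<close>.\<close>

section \<open>Difference quotients and mixed partials of jointly holomorphic functions\<close>

text \<open>Cauchy's inequality bounds the second derivative near \<open>t\<close>, and Taylor's
  formula of order one turns this into an error linear in \<open>h\<close>. The constant depends
  only on \<open>M\<close> and \<open>r\<close>, so for a family of functions with a common bound
  the difference quotients converge uniformly.\<close>

lemma difference_quotient_bound:
  fixes f :: "complex \<Rightarrow> complex"
  assumes "f holomorphic_on S" and "open S" and "cball t r \<subseteq> S" and "0 < r"
    and bound: "\<And>u. u \<in> cball t r \<Longrightarrow> norm (f u) \<le> M"
    and "norm h < r / 2" and "h \<noteq> 0"
  shows "norm ((f (t + h) - f t) / h - deriv f t) \<le> 8 * M / r\<^sup>2 * norm h"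
proof -
  have second: "norm ((deriv ^^ 2) f x) \<le> 8 * M / r\<^sup>2" if "x \<in> ball t (r / 2)" for x
  proof -
    have sub: "cball x (r / 2) \<subseteq> cball t r"
    proof
      fix y assume "y \<in> cball x (r / 2)"
      then show "y \<in> cball t r"
        using that dist_triangle[of t y x] by (simp add: dist_commute)
    qed
    \<comment> \<open>Half of \<open>r\<close> is spent on moving the center from \<open>t\<close>
      to \<open>x\<close>, the other half is the Cauchy radius; hence 2M/(r/2)^2 = 8M/r^2.\<close>
    have "norm ((deriv ^^ 2) f x) \<le> fact 2 * M / (r / 2) ^ 2"
    proof (rule Cauchy_inequality)
      show "f holomorphic_on ball x (r / 2)"
        using assms(1,3) sub by (meson ball_subset_cball holomorphic_on_subset order_trans)
      show "continuous_on (cball x (r / 2)) f"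
        using assms(1,3) sub by (meson holomorphic_on_imp_continuous_on holomorphic_on_subset order_trans)
      show "norm (f y) \<le> M" if "norm (x - y) = r / 2" for y
        using bound sub that by (auto simp: dist_norm)
    qed (use \<open>0 < r\<close> in auto)
    then show ?thesis
      by (simp add: power_divide mult.commute)
  qed
  have "norm ((deriv ^^ 0) f (t + h) - (\<Sum>i\<le>1. (deriv ^^ i) f t * (t + h - t) ^ i / fact i))
      \<le> 8 * M / r\<^sup>2 * norm (t + h - t) ^ Suc 1 / fact 1"
  proof (rule complex_Taylor[where S = "ball t (r / 2)" and f = "\<lambda>i. (deriv ^^ i) f"])
    show "((deriv ^^ i) f has_field_derivative (deriv ^^ Suc i) f x) (at x within ball t (r / 2))"
      if "x \<in> ball t (r / 2)" for i x
    proof -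
      have "x \<in> S"
        using that assms(3,4) by (auto simp: subset_iff)
      then show ?thesis
        using holomorphic_higher_deriv[OF assms(1,2)] assms(2)
        by (auto intro: has_field_derivative_at_within holomorphic_derivI)
    qed
  qed (use assms second in \<open>auto simp: numeral_2_eq_2 dist_norm\<close>)
  then have "norm (f (t + h) - f t - deriv f t * h) \<le> 8 * M / r\<^sup>2 * norm h ^ 2"
    by (simp add: algebra_simps numeral_2_eq_2)
  moreover have "(f (t + h) - f t) / h - deriv f t = (f (t + h) - f t - deriv f t * h) / h"
    using \<open>h \<noteq> 0\<close> by (simp add: field_simps)
  ultimately show ?thesis
    using \<open>h \<noteq> 0\<close> by (simp add: norm_divide divide_le_eq power2_eq_square mult.assoc)
qed

text \<open>The chain rule along the slices s -> (s, t) and u -> (z, u) picks out one coefficient of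
  the total derivative each.\<close>

lemma sections_of_complex_derivative:
  fixes g :: "complex \<Rightarrow> complex \<Rightarrow> complex"
  assumes "((\<lambda>y. g (fst y) (snd y)) has_derivative (\<lambda>v. a * fst v + b * snd v)) (at (z, t))"
  shows "((\<lambda>s. g s t) has_field_derivative a) (at z)"
    and "(g z has_field_derivative b) (at t)"
proof -
  have "((\<lambda>y. g (fst y) (snd y)) \<circ> (\<lambda>s. (s, t)) has_derivative
      (\<lambda>v. a * fst v + b * snd v) \<circ> (\<lambda>v. (v, 0))) (at z)"
    by (rule diff_chain_at) (use assms in \<open>auto intro!: derivative_eq_intros\<close>)
  then show "((\<lambda>s. g s t) has_field_derivative a) (at z)"
    by (simp add: has_field_derivative_def o_def)
  have "((\<lambda>y. g (fst y) (snd y)) \<circ> (\<lambda>u. (z, u)) has_derivative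
      (\<lambda>v. a * fst v + b * snd v) \<circ> (\<lambda>v. (0, v))) (at t)"
    by (rule diff_chain_at) (use assms in \<open>auto intro!: derivative_eq_intros\<close>)
  then show "(g z has_field_derivative b) (at t)"
    by (simp add: has_field_derivative_def o_def)
qed

text \<open>The \<open>t\<close>-difference quotients converge locally uniformly in \<open>z\<close>, so by Weierstrass their limit
  \<open>g\<^sub>t\<close> is differentiable in \<open>z\<close> and their \<open>z\<close>-derivatives, which are the difference quotients of
  \<open>g\<^sub>z\<close>, converge to \<open>g\<^sub>t\<^sub>z\<close>.\<close>

lemma mixed_partials_complex:
  fixes g :: "complex \<Rightarrow> complex \<Rightarrow> complex"
  assumes "open D" and "(z, t) \<in> D"
    and diff: "\<And>x. x \<in> D \<Longrightarrow> \<exists>a b. ((\<lambda>y. g (fst y) (snd y)) has_derivative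
                              (\<lambda>v. a * fst v + b * snd v)) (at x)"
  obtains c where "((\<lambda>s. deriv (g s) t) has_field_derivative c) (at z)"
    and "((\<lambda>u. deriv (\<lambda>s. g s u) z) has_field_derivative c) (at t)"
proof -
  obtain V W where "open V" "open W" "(z, t) \<in> V \<times> W" and VW: "V \<times> W \<subseteq> D"
    using assms(1,2) by (rule open_prod_elim)
  obtain r1 where r1: "0 < r1" "cball z r1 \<subseteq> V"
    using \<open>open V\<close> \<open>(z, t) \<in> V \<times> W\<close> by (auto simp: open_contains_cball)
  obtain r2 where r2: "0 < r2" "cball t r2 \<subseteq> W"
    using \<open>open W\<close> \<open>(z, t) \<in> V \<times> W\<close> by (auto simp: open_contains_cball)
  \<comment> \<open>A common radius gives a closed bidisc inside \<open>D\<close>, on which the two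
    variables range independently.\<close>
  define r where "r = min r1 r2"
  have r: "0 < r" "cball z r \<subseteq> V" "cball t r \<subseteq> W"
    using r1 r2 by (auto simp: r_def subset_iff)
  have dz: "((\<lambda>s. g s u) has_field_derivative deriv (\<lambda>s. g s u) s) (at s)"
    and dt: "(g s has_field_derivative deriv (g s) u) (at u)" if su: "s \<in> V" "u \<in> W" for s u
  proof -
    obtain a b where "((\<lambda>y. g (fst y) (snd y)) has_derivative (\<lambda>v. a * fst v + b * snd v)) (at (s, u))"
      using diff[of "(s, u)"] su VW by blast
    note der = sections_of_complex_derivative[OF this]
    show "((\<lambda>s. g s u) has_field_derivative deriv (\<lambda>s. g s u) s) (at s)"
      and "(g s has_field_derivative deriv (g s) u) (at u)"
      using der by (simp_all add: DERIV_imp_deriv[OF der(1)] DERIV_imp_deriv[OF der(2)])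
  qed
  \<comment> \<open>Joint continuity on the compact bidisc yields a bound \<open>M\<close> that does
    not depend on \<open>s\<close>; this is the source of uniformity in the limit below.\<close>
  have "continuous_on D (\<lambda>y. g (fst y) (snd y))"
    using diff by (meson continuous_at_imp_continuous_on has_derivative_continuous)
  then have "continuous_on (cball z r \<times> cball t r) (\<lambda>y. g (fst y) (snd y))"
    by (rule continuous_on_subset) (use r VW in blast)
  then have "bounded ((\<lambda>y. g (fst y) (snd y)) ` (cball z r \<times> cball t r))"
    by (intro compact_imp_bounded compact_continuous_image compact_Times compact_cball)
  then obtain M where M: "\<And>s u. s \<in> cball z r \<Longrightarrow> u \<in> cball t r \<Longrightarrow> norm (g s u) \<le> M"
    by (fastforce simp: bounded_iff)
  define Q where "Q h s = (g s (t + h) - g s t) / h" for h s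
  define Q' where "Q' h s = (deriv (\<lambda>s. g s (t + h)) s - deriv (\<lambda>s. g s t) s) / h" for h s
  have small: "\<forall>\<^sub>F h in at 0. h \<noteq> 0 \<and> norm h < e" if "0 < e" for e and x :: complex
    using that by (auto simp: eventually_at dist_norm)
  have "\<forall>\<^sub>F h in at 0. continuous_on (cball z r) (Q h) \<and>
      (\<forall>s\<in>ball z r. (Q h has_field_derivative Q' h s) (at s))"
    using small[OF \<open>0 < r\<close>]
  proof eventually_elim
    case (elim h)
    have "t + h \<in> cball t r" "t \<in> cball t r"
      using elim r(1) by (auto simp: dist_norm)
    then have "t + h \<in> W" "t \<in> W"
      using r by auto
    then have der: "(Q h has_field_derivative Q' h s) (at s)" if "s \<in> V" for s
      unfolding Q_def Q'_def using elim that by (intro DERIV_cdivide DERIV_diff dz) auto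
    then have "continuous_on (cball z r) (Q h)"
      using r(2) by (meson DERIV_isCont continuous_at_imp_continuous_on subsetD)
    with der r(2) show ?case
      by (meson ball_subset_cball subsetD)
  qed
  moreover have "uniform_limit (cball z r) Q (\<lambda>s. deriv (g s) t) (at 0)"
  proof (rule uniform_limitI)
    fix e :: real assume "0 < e"
    \<comment> \<open>\<open>max M 0\<close> makes the first summand nonnegative, and adding 1 makes
      \<open>K\<close> positive, so that dividing by it is legitimate.\<close>
    define K where "K = 8 * max M 0 / r\<^sup>2 + 1"
    have "0 < K"
      by (simp add: K_def add_nonneg_pos)
    have "0 < min (r / 2) (e / K)"
      using \<open>0 < e\<close> \<open>0 < K\<close> r by simp
    from small[OF this] show "\<forall>\<^sub>F h in at 0. \<forall>s\<in>cball z r. dist (Q h s) (deriv (g s) t) < e"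
    proof eventually_elim
      case (elim h)
      show ?case
      proof
        fix s assume s: "s \<in> cball z r"
        have "norm (Q h s - deriv (g s) t) \<le> 8 * max M 0 / r\<^sup>2 * norm h"
          unfolding Q_def
        proof (rule difference_quotient_bound)
          show "g s holomorphic_on W"
            using dt s r \<open>open W\<close> by (meson holomorphic_on_open subsetD)
          show "norm (g s u) \<le> max M 0" if "u \<in> cball t r" for u
            using M[OF s that] by simp
        qed (use elim r \<open>open W\<close> in auto)
        also have "\<dots> \<le> K * norm h"
          by (simp add: K_def distrib_right)
        also have "\<dots> < e"
          using elim \<open>0 < K\<close> by (simp add: less_divide_eq mult.commute)
        finally show "dist (Q h s) (deriv (g s) t) < e"
          by (simp add: dist_norm)
      qed
    qed
  qed
  ultimately obtain c where
    "\<And>s. s \<in> ball z r \<Longrightarrow> ((\<lambda>s. deriv (g s) t) has_field_derivative c s) (at s) \<and>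
        ((\<lambda>h. Q' h s) \<longlongrightarrow> c s) (at 0)"
    using has_complex_derivative_uniform_limit[OF _ _ at_neq_bot \<open>0 < r\<close>] by blast
  then have "((\<lambda>s. deriv (g s) t) has_field_derivative c z) (at z)" "((\<lambda>h. Q' h z) \<longlongrightarrow> c z) (at 0)"
    using r(1) by auto
  \<comment> \<open>At the center, convergence of \<open>Q' h z\<close> to \<open>c z\<close> is, by
    the definition of the derivative, differentiability in t of the z-derivative of
    \<open>g\<close>.\<close>
  then show thesis
    using that unfolding Q'_def by (simp add: DERIV_def)
qed

section \<open>Commutation as a zero-curvature equation\<close>

text \<open>Applying d/dz + A to f_t + Bf differentiates \<open>B\<close> in z only, and applying
  d/dt + B to f_z + Af differentiates \<open>A\<close> in t only; \<open>A'\<close> and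
  \<open>B'\<close> record these derivatives entrywise.\<close>

lemma operators_commute_on_iff_zero_curvature:
  fixes A B A' B' :: "complex \<Rightarrow> complex \<Rightarrow> complex ^ 'n ^ 'n"
  assumes "open D"
    and A: "\<And>z t i j. (z, t) \<in> D \<Longrightarrow> ((\<lambda>u. A z u $ i $ j) has_field_derivative A' z t $ i $ j) (at t)"
    and B: "\<And>z t i j. (z, t) \<in> D \<Longrightarrow> ((\<lambda>s. B s t $ i $ j) has_field_derivative B' z t $ i $ j) (at z)"
  shows "operators_commute_on D A B \<longleftrightarrow>
    (\<forall>(z, t)\<in>D. A' z t = B' z t + A z t ** B z t - B z t ** A z t)"
proof -
  define F where "F z t = B' z t + A z t ** B z t - B z t ** A z t - A' z t" for z t
  have commutator: "operator_z A (operator_t B f) z t - operator_t B (operator_z A f) z t = F z t *v f z t"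
    if f: "holomorphic2_on f D" and D: "(z, t) \<in> D" for f z t
  proof -
    have diff: "\<exists>a b. ((\<lambda>y. f (fst y) (snd y) $ i) has_derivative (\<lambda>v. a * fst v + b * snd v)) (at x)"
      if "x \<in> D" for x i
      using f that by (auto simp: holomorphic2_on_def)
    have sections: "((\<lambda>s. f s t $ i) has_field_derivative partial_z f z t $ i) (at z) \<and>
        ((\<lambda>u. f z u $ i) has_field_derivative partial_t f z t $ i) (at t)" for i
    proof -
      obtain a b where "((\<lambda>y. f (fst y) (snd y) $ i) has_derivative
          (\<lambda>v. a * fst v + b * snd v)) (at (z, t))"
        using diff[OF D] by blast
      note der = sections_of_complex_derivative[OF this]
      then show ?thesis
        by (simp add: partial_z_def partial_t_def DERIV_imp_deriv[OF der(1)] DERIV_imp_deriv[OF der(2)])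
    qed
    have fz: "((\<lambda>s. f s t $ i) has_field_derivative partial_z f z t $ i) (at z)"
      and ft: "((\<lambda>u. f z u $ i) has_field_derivative partial_t f z t $ i) (at t)" for i
      using sections by auto
    \<comment> \<open>Both iterated operators contain the same mixed partial \<open>c\<close>, which
      therefore cancels in their difference.\<close>
    have "\<exists>c. ((\<lambda>s. partial_t f s t $ i) has_field_derivative c) (at z) \<and>
        ((\<lambda>u. partial_z f z u $ i) has_field_derivative c) (at t)" for i
      using mixed_partials_complex[OF \<open>open D\<close> D diff, of i]
      by (simp add: partial_z_def partial_t_def) metis
    then obtain c where ftz: "\<And>i. ((\<lambda>s. partial_t f s t $ i) has_field_derivative c i) (at z)"
      and fzt: "\<And>i. ((\<lambda>u. partial_z f z u $ i) has_field_derivative c i) (at t)"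
      by metis
    have ds: "((\<lambda>s. operator_t B f s t $ i) has_field_derivative
        c i + (\<Sum>j\<in>UNIV. B' z t $ i $ j * f z t $ j + partial_z f z t $ j * B z t $ i $ j)) (at z)" for i
      unfolding operator_t_def matrix_vector_mult_def vector_add_component vec_lambda_beta
      by (intro DERIV_add DERIV_sum DERIV_mult ftz fz B D)
    have pz: "partial_z (operator_t B f) z t =
        (\<chi> i. c i) + B' z t *v f z t + B z t *v partial_z f z t"
      by (simp add: partial_z_def[of "operator_t B f"] DERIV_imp_deriv[OF ds] vec_eq_iff
          matrix_vector_mult_def sum.distrib mult.commute)
    have du: "((\<lambda>u. operator_z A f z u $ i) has_field_derivative
        c i + (\<Sum>j\<in>UNIV. A' z t $ i $ j * f z t $ j + partial_t f z t $ j * A z t $ i $ j)) (at t)" for i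
      unfolding operator_z_def matrix_vector_mult_def vector_add_component vec_lambda_beta
      by (intro DERIV_add DERIV_sum DERIV_mult fzt ft A D)
    have pt: "partial_t (operator_z A f) z t =
        (\<chi> i. c i) + A' z t *v f z t + A z t *v partial_t f z t"
      by (simp add: partial_t_def[of "operator_z A f"] DERIV_imp_deriv[OF du] vec_eq_iff
          matrix_vector_mult_def sum.distrib mult.commute)
    show ?thesis
      unfolding operator_z_def[of A "operator_t B f"] operator_t_def[of B "operator_z A f"] pz pt
      by (simp add: operator_z_def operator_t_def F_def matrix_vector_mul_assoc
          matrix_vector_right_distrib matrix_vector_mult_add_rdistrib matrix_vector_mult_diff_rdistrib)
  qed
  have "operators_commute_on D A B \<longleftrightarrow> (\<forall>(z, t)\<in>D. F z t = 0)"
  proof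
    assume comm: "operators_commute_on D A B"
    \<comment> \<open>A constant field takes any prescribed value \<open>v\<close> at the point, so
      the matrix \<open>F z t\<close> annihilates every vector.\<close>
    have "F z t *v v = 0 *v v" if D: "(z, t) \<in> D" for z t v
    proof -
      have const: "holomorphic2_on (\<lambda>_ _. v) D"
        unfolding holomorphic2_on_def by (auto intro!: exI[of _ 0])
      have "operator_z A (operator_t B (\<lambda>_ _. v)) z t = operator_t B (operator_z A (\<lambda>_ _. v)) z t"
        using comm const D unfolding operators_commute_on_def by blast
      then show ?thesis
        using commutator[OF const D] by simp
    qed
    then show "\<forall>(z, t)\<in>D. F z t = 0"
      by (auto simp: matrix_eq)
  next
    assume "\<forall>(z, t)\<in>D. F z t = 0"
    then show "operators_commute_on D A B"
      using commutator unfolding operators_commute_on_def by fastforce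
  qed
  then show ?thesis
    by (fastforce simp: F_def)
qed

section \<open>Two-by-two matrices and the algebra of the pencil\<close>

lemma mat22_nth [simp]:
  "mat22 a b c d $ 1 $ 1 = a" "mat22 a b c d $ 1 $ 2 = b"
  "mat22 a b c d $ 2 $ 1 = c" "mat22 a b c d $ 2 $ 2 = d"
  by (simp_all add: mat22_def)

lemma mat22_arith:
  "mat22 a b c d + mat22 a' b' c' d' = mat22 (a + a') (b + b') (c + c') (d + d')"
  "mat22 a b c d - mat22 a' b' c' d' = mat22 (a - a') (b - b') (c - c') (d - d')"
  "mat22 a b c d ** mat22 a' b' c' d' =
    mat22 (a * a' + b * c') (a * b' + b * d') (c * a' + d * c') (c * b' + d * d')"
  "x *\<^sub>m mat22 a b c d = mat22 (x * a) (x * b) (x * c) (x * d)"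
  "mat22 a b c d = mat22 a' b' c' d' \<longleftrightarrow> a = a' \<and> b = b' \<and> c = c' \<and> d = d'"
  by (auto simp: vec_eq_iff forall_2 matrix_matrix_mult_def sum_2 mat_scale_def)

text \<open>With \<open>u = 1/z\<close> and \<open>c = 1/t\<close> every entry is polynomial; primed variables stand for
  \<open>t\<close>-derivatives, and their relations come from differentiating \<open>kq = w\<^sup>2\<close> and
  \<open>q\<^sup>2h = w\<^sup>2 + \<theta>qw - q\<close>.\<close>

lemma zero_curvature_pencil_iff:
  fixes z u T c b \<theta> Q W K H Q' W' K' H' :: complex
  assumes "u * z = 1" "c * T = 1" "2 * b = Q + \<theta> * c" "Q \<noteq> 0"
    and K: "K * Q = W\<^sup>2" and H: "Q\<^sup>2 * H = W\<^sup>2 + \<theta> * Q * W - Q"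
    and K': "K' * Q + K * Q' = 2 * W * W'"
    and H': "Q\<^sup>2 * H' + 2 * Q * Q' * H = 2 * W * W' + \<theta> * (Q' * W + Q * W') - Q'"
  defines "a \<equiv> u\<^sup>2 * W + u * \<theta> / 2 + T / 2"
  defines "MA \<equiv> mat22 a (u\<^sup>2 * K + u * H) (u - u\<^sup>2 * Q) (- a)"
    and "MB \<equiv> mat22 (z / 2 + b) (c * H) c (- (z / 2 + b))"
  shows "mat22 (u\<^sup>2 * W' + 1 / 2) (u\<^sup>2 * K' + u * H') (- (u\<^sup>2 * Q')) (- (u\<^sup>2 * W' + 1 / 2)) =
      B_lin + MA ** MB - MB ** MA \<longleftrightarrow>
    Q' = 2 * b * Q + 2 * c * W \<and> W' = c * (K + Q * H)"
proof -
  have "u \<noteq> 0"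
    using assms(1) by auto
  \<comment> \<open>In the upper left entry the terms linear in \<open>u\<close> cancel, leaving a
    multiple of \<open>u\<^sup>2\<close>.\<close>
  have "u\<^sup>2 * W' + 1 / 2 - (1 / 2 + (u\<^sup>2 * K + u * H) * c - c * H * (u - u\<^sup>2 * Q))
      = u\<^sup>2 * (W' - c * (K + Q * H))"
    by (simp add: algebra_simps)
  then have e11: "u\<^sup>2 * W' + 1 / 2 = 1 / 2 + (u\<^sup>2 * K + u * H) * c - c * H * (u - u\<^sup>2 * Q)
      \<longleftrightarrow> W' = c * (K + Q * H)"
    using \<open>u \<noteq> 0\<close> by (metis eq_iff_diff_eq_0 mult_eq_0_iff power_not_zero)
  have "2 * a = 2 * u\<^sup>2 * W + u * \<theta> + T"
    by (simp add: a_def)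
  then have a: "2 * c * a = 2 * u\<^sup>2 * c * W + u * \<theta> * c + 1"
    using assms(2) by algebra
  \<comment> \<open>In the lower left entry \<open>u * z = 1\<close> cancels the constant term, and
    the linear coefficient 2b - Q - \<theta>c vanishes by the choice of \<open>b\<close>.\<close>
  have "- (u\<^sup>2 * Q') - ((u - u\<^sup>2 * Q) * (z + 2 * b) - 2 * c * a)
      = u\<^sup>2 * (2 * b * Q + 2 * c * W - Q')"
    using a assms(1,3) by algebra
  then have e21: "- (u\<^sup>2 * Q') = (u - u\<^sup>2 * Q) * (z + 2 * b) - 2 * c * a
      \<longleftrightarrow> Q' = 2 * b * Q + 2 * c * W"
    using \<open>u \<noteq> 0\<close> by (metis eq_iff_diff_eq_0 mult_eq_0_iff power_not_zero)
  have e12: "u\<^sup>2 * K' + u * H' = 2 * c * a * H - (z + 2 * b) * (u\<^sup>2 * K + u * H)"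
    if "Q' = 2 * b * Q + 2 * c * W" "W' = c * (K + Q * H)"
  proof -
    \<comment> \<open>The upper right entry asks for K' = 2cHW - 2bK at \<open>u\<^sup>2\<close> and
      for H' = -K - QH at \<open>u\<close>. The differentiated relations give these only after
      multiplication by \<open>Q\<close> and \<open>Q ^ 2\<close>, which are then cancelled.\<close>
    have "Q * (K' - (2 * c * H * W - 2 * b * K)) = 0"
      using that K K' by algebra
    then have "K' = 2 * c * H * W - 2 * b * K"
      using \<open>Q \<noteq> 0\<close> by simp
    moreover have "Q ^ 2 * (H' + K + Q * H) = 0"
      using that K H H' assms(3) by algebra
    then have "H' + K + Q * H = 0"
      using \<open>Q \<noteq> 0\<close> by simp
    then have "H' = - K - Q * H"
      by algebra
    ultimately show ?thesis
      using a assms(1,3) by algebra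
  qed
  \<comment> \<open>The lower right entry repeats the upper left one with opposite sign, since a
    commutator has trace zero.\<close>
  show ?thesis
    using e11 e21 e12
    by (auto simp: MA_def MB_def B_lin_def mat22_arith algebra_simps)
qed

section \<open>Hamiltonian form and the second-order equation\<close>

lemma Ham_p_eq:
  assumes "Q \<noteq> 0" "T \<noteq> 0"
  shows "Ham_p \<theta> P Q T = - 2 * P / (Q\<^sup>2 * T)"
proof -
  have "((\<lambda>x. Ham \<theta> x Q T) has_field_derivative - 2 * P / (Q\<^sup>2 * T)) (at P)"
    unfolding Ham_def using assms by (auto intro!: derivative_eq_intros simp: field_simps)
  then show ?thesis
    unfolding Ham_p_def by (rule DERIV_imp_deriv)
qed

lemma Ham_q_eq:
  assumes "Q \<noteq> 0" "T \<noteq> 0"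
  shows "Ham_q \<theta> P Q T = 2 * P\<^sup>2 / (Q ^ 3 * T) + Q * T / 2 + (\<theta> + 1) / 2 - 1 / (Q\<^sup>2 * T)"
proof -
  have "((\<lambda>x. Ham \<theta> P x T) has_field_derivative
      2 * P\<^sup>2 / (Q ^ 3 * T) + Q * T / 2 + (\<theta> + 1) / 2 - 1 / (Q\<^sup>2 * T)) (at Q)"
    unfolding Ham_def using assms
    by (auto intro!: derivative_eq_intros simp: field_simps power2_eq_square power3_eq_cube)
  then show ?thesis
    unfolding Ham_q_def by (rule DERIV_imp_deriv)
qed

text \<open>The factor \<open>Q ^ 2\<close> is that of the Poisson bracket {p, q} = q^2, for which
  q' = {q, H} and p' = {p, H}. Independent values \<open>P\<close>, \<open>Q\<close>,
  \<open>T\<close> make the identities hold for the vector field itself and hence along every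
  trajectory.\<close>

lemma hamiltonian_vector_field:
  assumes "Q \<noteq> 0" "T \<noteq> 0"
  shows "- (Q ^ 2) * Ham_p \<theta> P Q T = 2 * P / T"
    and "Q ^ 2 * Ham_q \<theta> P Q T =
      2 * P ^ 2 / (T * Q) + T * Q ^ 3 / 2 + (1 / 2) * (\<theta> + 1) * Q ^ 2 - 1 / T"
  using assms by (simp_all add: Ham_p_eq Ham_q_eq field_simps power2_eq_square power3_eq_cube)

text \<open>The first equation says p = tq'/2, so p' = q'/2 + tq''/2; with this inserted, the defect
  of the second equation is t/2 times the defect of the Painleve equation.\<close>

lemma pq_system_iff_painleve:
  assumes "open U" and "0 \<notin> U" and "p holomorphic_on U" and "q holomorphic_on U"
    and q0: "\<And>t. t \<in> U \<Longrightarrow> q t \<noteq> 0"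
  shows "pq_system \<theta> U p q \<longleftrightarrow>
    (\<forall>t\<in>U. p t = t / 2 * deriv q t) \<and> painleve_III_D7 \<theta> U q"
proof -
  have first: "deriv q t = 2 * p t / t \<longleftrightarrow> p t = t / 2 * deriv q t" if "t \<in> U" for t
    using that assms(2) by (auto simp: field_simps)
  have second: "deriv p t = 2 * (p t) ^ 2 / (t * q t) + t * (q t) ^ 3 / 2
        + (1 / 2) * (\<theta> + 1) * (q t) ^ 2 - 1 / t \<longleftrightarrow>
      deriv (deriv q) t =
        (deriv q t) ^ 2 / q t - deriv q t / t + (\<theta> + 1) * (q t) ^ 2 / t + (q t) ^ 3 - 2 / t ^ 2"
    \<comment> \<open>The relation is taken on all of \<open>U\<close> because it has to be
      differentiated at \<open>t\<close>.\<close>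
    if p: "\<forall>t\<in>U. p t = t / 2 * deriv q t" and t: "t \<in> U" for t
  proof -
    have [simp]: "t \<noteq> 0" "q t \<noteq> 0"
      using t assms(2) q0 by auto
    have "(deriv q has_field_derivative deriv (deriv q) t) (at t)"
      using assms(1,4) t by (meson holomorphic_deriv holomorphic_derivI)
    then have "((\<lambda>t. t / 2 * deriv q t) has_field_derivative
        deriv q t / 2 + t / 2 * deriv (deriv q) t) (at t)"
      by (auto intro!: derivative_eq_intros)
    then have "(p has_field_derivative deriv q t / 2 + t / 2 * deriv (deriv q) t) (at t)"
      using \<open>open U\<close> t by (rule has_field_derivative_transform_within_open) (use p in auto)
    then have dp: "deriv p t = deriv q t / 2 + t / 2 * deriv (deriv q) t"
      by (rule DERIV_imp_deriv)
    have pt: "p t = t / 2 * deriv q t"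
      using p t by blast
    have "deriv p t - (2 * (p t) ^ 2 / (t * q t) + t * (q t) ^ 3 / 2
          + (1 / 2) * (\<theta> + 1) * (q t) ^ 2 - 1 / t)
        = t / 2 * (deriv (deriv q) t - ((deriv q t) ^ 2 / q t - deriv q t / t
          + (\<theta> + 1) * (q t) ^ 2 / t + (q t) ^ 3 - 2 / t ^ 2))"
      unfolding dp pt by (simp add: field_simps power2_eq_square power3_eq_cube)
    then show ?thesis
      by (metis \<open>t \<noteq> 0\<close> divide_eq_0_iff eq_iff_diff_eq_0 mult_eq_0_iff zero_neq_numeral)
  qed
  show ?thesis
    unfolding pq_system_def painleve_III_D7_def using first second by blast
qed

section \<open>The concrete connection in terms of w, h and q\<close>

text \<open>This is the shape of \<open>MA\<close> in \<open>zero_curvature_pencil_iff\<close>, with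
  u = 1/z.\<close>

lemma conn_A_eq:
  "conn_A \<theta> p q z t =
    (let u = 1 / z; w = w_fun \<theta> (p t) (q t) t; h = h_fun \<theta> (p t) (q t) t;
         a = u\<^sup>2 * w + u * \<theta> / 2 + t / 2
     in mat22 a (u\<^sup>2 * (w\<^sup>2 / q t) + u * h) (u - u\<^sup>2 * q t) (- a))"
  by (simp add: conn_A_def A0_def A1_def A2_def mat22_arith power_one_over Let_def)

lemma conn_B_eq:
  "conn_B \<theta> p q z t =
    (let b = z / 2 + (q t / 2 + \<theta> / (2 * t))
     in mat22 b (1 / t * h_fun \<theta> (p t) (q t) t) (1 / t) (- b))"
  by (simp add: conn_B_def B_lin_def B_const_def mat22_arith Let_def)

text \<open>With s = 2p - tq^2 one has w = (s - \<theta>q)/2, so w^2 + \<theta>qw = w(w + \<theta>q)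
  = (s^2 - \<theta>^2 q^2)/4 is a difference of squares; subtracting q gives the numerator of h
  divided by 4.\<close>

lemma h_fun_via_w_fun:
  assumes "q \<noteq> 0"
  shows "q\<^sup>2 * h_fun \<theta> p q t = (w_fun \<theta> p q t)\<^sup>2 + \<theta> * q * w_fun \<theta> p q t - q"
  using assms by (simp add: h_fun_def w_fun_def field_simps) (simp add: algebra_simps power2_eq_square power4_eq_xxxx)

text \<open>This eliminates w: the left side of the second equation is w' expanded by the chain
  rule. There p' has coefficient 1, so once q' is known the two forms of that equation have the same
  defect.\<close>

lemma pq_system_via_w_fun:
  fixes p q t p' q' \<theta> :: complex
  assumes "t \<noteq> 0" "q \<noteq> 0"
  defines "w \<equiv> w_fun \<theta> p q t" and "h \<equiv> h_fun \<theta> p q t"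
  shows "q' = 2 * (q / 2 + \<theta> / (2 * t)) * q + 2 * (1 / t) * w \<and>
      1 / 2 * (- q\<^sup>2 - 2 * t * q * q' - \<theta> * q' + 2 * p') = 1 / t * (w\<^sup>2 / q + q * h) \<longleftrightarrow>
    q' = 2 * p / t \<and> p' = 2 * p ^ 2 / (t * q) + t * q ^ 3 / 2 + (1 / 2) * (\<theta> + 1) * q ^ 2 - 1 / t"
proof -
  have first: "2 * (q / 2 + \<theta> / (2 * t)) * q + 2 * (1 / t) * w = 2 * p / t"
    using assms by (simp add: w_def w_fun_def field_simps power2_eq_square)
  have qh: "q * h = (w\<^sup>2 + \<theta> * q * w - q) / q"
    using h_fun_via_w_fun[OF \<open>q \<noteq> 0\<close>] \<open>q \<noteq> 0\<close>
    by (simp add: h_def w_def field_simps power2_eq_square)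
  have "1 / 2 * (- q\<^sup>2 - 2 * t * q * q' - \<theta> * q' + 2 * p') - 1 / t * (w\<^sup>2 / q + q * h)
      = p' - (2 * p ^ 2 / (t * q) + t * q ^ 3 / 2 + (1 / 2) * (\<theta> + 1) * q ^ 2 - 1 / t)"
    if "q' = 2 * p / t"
    unfolding qh that w_def w_fun_def using assms(1,2)
    by (simp add: field_simps power2_eq_square power3_eq_cube)
  then show ?thesis
    unfolding first by (metis eq_iff_diff_eq_0)
qed

lemma deriv_eq_on_open:
  assumes "(f has_field_derivative f') (at t)" and "(g has_field_derivative g') (at t)"
    and "open U" and "t \<in> U" and "\<And>s. s \<in> U \<Longrightarrow> f s = g s"
  shows "f' = g'"
  using has_field_derivative_transform_within_open[OF assms(1,3-5)] assms(2) by (rule DERIV_unique)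

lemma connection_commutes_iff_pq_system:
  assumes "open U" and "0 \<notin> U" and "p holomorphic_on U" and "q holomorphic_on U"
    and q0: "\<And>t. t \<in> U \<Longrightarrow> q t \<noteq> 0"
  shows "operators_commute_on ((- {0}) \<times> U) (conn_A \<theta> p q) (conn_B \<theta> p q) \<longleftrightarrow> pq_system \<theta> U p q"
proof -
  define w where "w t = w_fun \<theta> (p t) (q t) t" for t
  define h where "h t = h_fun \<theta> (p t) (q t) t" for t
  \<comment> \<open>\<open>k\<close> is the upper right entry of \<open>A0\<close>; it makes this
    trace-free matrix singular, hence nilpotent.\<close>
  define k where "k t = (w t)\<^sup>2 / q t" for t
  have holo: "w holomorphic_on U" "h holomorphic_on U" "k holomorphic_on U"
    unfolding k_def w_def h_def w_fun_def h_fun_def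
    using assms by (auto intro!: holomorphic_intros)
  note D = holomorphic_derivI[OF _ \<open>open U\<close>]
  define A' where "A' z t = mat22 ((1 / z)\<^sup>2 * deriv w t + 1 / 2) ((1 / z)\<^sup>2 * deriv k t + 1 / z * deriv h t)
      (- ((1 / z)\<^sup>2 * deriv q t)) (- ((1 / z)\<^sup>2 * deriv w t + 1 / 2))" for z t
  have conn: "conn_A \<theta> p q z t = mat22 ((1 / z)\<^sup>2 * w t + 1 / z * \<theta> / 2 + t / 2)
      ((1 / z)\<^sup>2 * k t + 1 / z * h t) (1 / z - (1 / z)\<^sup>2 * q t)
      (- ((1 / z)\<^sup>2 * w t + 1 / z * \<theta> / 2 + t / 2))" for z t
    by (simp only: conn_A_eq Let_def w_def h_def k_def)
  have A: "((\<lambda>t. conn_A \<theta> p q z t $ i $ j) has_field_derivative A' z t $ i $ j) (at t)"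
    if t: "t \<in> U" for z t i j
  proof -
    note [derivative_intros] = D[OF holo(1) t] D[OF holo(2) t] D[OF holo(3) t] D[OF assms(4) t]
    define u where "u = 1 / z"
    have "((\<lambda>t. u\<^sup>2 * w t + u * \<theta> / 2 + t / 2) has_field_derivative u\<^sup>2 * deriv w t + 1 / 2) (at t)"
      and "((\<lambda>t. u\<^sup>2 * k t + u * h t) has_field_derivative u\<^sup>2 * deriv k t + u * deriv h t) (at t)"
      and "((\<lambda>t. u - u\<^sup>2 * q t) has_field_derivative - (u\<^sup>2 * deriv q t)) (at t)"
      by (auto intro!: derivative_eq_intros)
    then show ?thesis
      using exhaust_2[of i] exhaust_2[of j] unfolding conn A'_def u_def[symmetric]
      by (elim disjE) (simp_all only: mat22_nth DERIV_minus)
  qed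
  have B: "((\<lambda>z. conn_B \<theta> p q z t $ i $ j) has_field_derivative B_lin $ i $ j) (at z)" for z t i j
    using exhaust_2[of i] exhaust_2[of j]
    by (auto simp: conn_B_eq Let_def B_lin_def intro!: derivative_eq_intros)
  have pointwise: "A' z t = B_lin + conn_A \<theta> p q z t ** conn_B \<theta> p q z t
        - conn_B \<theta> p q z t ** conn_A \<theta> p q z t \<longleftrightarrow>
      deriv q t = 2 * p t / t \<and> deriv p t = 2 * (p t) ^ 2 / (t * q t) + t * (q t) ^ 3 / 2
                       + (1 / 2) * (\<theta> + 1) * (q t) ^ 2 - 1 / t"
    if "z \<noteq> 0" and t: "t \<in> U" for z t
  proof -
    have nz: "t \<noteq> 0" "q t \<noteq> 0"
      using t assms(2) q0 by auto
    note dp = D[OF assms(3) t] and dq = D[OF assms(4) t]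
      and dw = D[OF holo(1) t] and dh = D[OF holo(2) t] and dk = D[OF holo(3) t]
    note [derivative_intros] = dp dq
    \<comment> \<open>Only w' is expanded explicitly; k' and h' enter through implicit
      differentiation of their polynomial relations.\<close>
    have W': "deriv w t = 1 / 2 * (- (q t)\<^sup>2 - 2 * t * q t * deriv q t - \<theta> * deriv q t + 2 * deriv p t)"
      by (rule DERIV_imp_deriv)
        (auto simp: w_def[abs_def] w_fun_def algebra_simps intro!: derivative_eq_intros)
    note [derivative_intros] = dw dh dk
    have K': "deriv k t * q t + k t * deriv q t = 2 * w t * deriv w t"
    proof (rule deriv_eq_on_open[OF _ _ \<open>open U\<close> t])
      show "((\<lambda>s. k s * q s) has_field_derivative deriv k t * q t + k t * deriv q t) (at t)"
        by (auto intro!: derivative_eq_intros)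
      show "((\<lambda>s. (w s)\<^sup>2) has_field_derivative 2 * w t * deriv w t) (at t)"
        by (auto intro!: derivative_eq_intros)
    qed (use q0 in \<open>simp add: k_def\<close>)
    have H': "(q t)\<^sup>2 * deriv h t + 2 * q t * deriv q t * h t =
        2 * w t * deriv w t + \<theta> * (deriv q t * w t + q t * deriv w t) - deriv q t"
    proof (rule deriv_eq_on_open[OF _ _ \<open>open U\<close> t])
      show "((\<lambda>s. (q s)\<^sup>2 * h s) has_field_derivative
          (q t)\<^sup>2 * deriv h t + 2 * q t * deriv q t * h t) (at t)"
        by (auto intro!: derivative_eq_intros)
      show "((\<lambda>s. (w s)\<^sup>2 + \<theta> * q s * w s - q s) has_field_derivative
          2 * w t * deriv w t + \<theta> * (deriv q t * w t + q t * deriv w t) - deriv q t) (at t)"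
        by (auto intro!: derivative_eq_intros simp: algebra_simps)
    qed (use q0 h_fun_via_w_fun in \<open>simp add: h_def w_def\<close>)
    have "A' z t = B_lin + conn_A \<theta> p q z t ** conn_B \<theta> p q z t
          - conn_B \<theta> p q z t ** conn_A \<theta> p q z t \<longleftrightarrow>
        deriv q t = 2 * (q t / 2 + \<theta> / (2 * t)) * q t + 2 * (1 / t) * w t \<and>
        deriv w t = 1 / t * (k t + q t * h t)"
      unfolding A'_def conn conn_B_eq Let_def h_def[symmetric]
    proof (rule zero_curvature_pencil_iff[OF _ _ _ nz(2) _ _ K' H'])
      show "1 / z * z = 1" "1 / t * t = 1" "k t * q t = (w t)\<^sup>2"
        "2 * (q t / 2 + \<theta> / (2 * t)) = q t + \<theta> * (1 / t)"
        using \<open>z \<noteq> 0\<close> nz by (simp_all add: k_def)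
      show "(q t)\<^sup>2 * h t = (w t)\<^sup>2 + \<theta> * q t * w t - q t"
        using h_fun_via_w_fun[OF nz(2)] by (simp add: h_def w_def)
    qed
    then show ?thesis
      unfolding W' unfolding k_def w_def h_def using pq_system_via_w_fun[OF nz] by simp
  qed
  have "operators_commute_on ((- {0}) \<times> U) (conn_A \<theta> p q) (conn_B \<theta> p q) \<longleftrightarrow>
      (\<forall>(z, t)\<in>(- {0}) \<times> U. A' z t = B_lin + conn_A \<theta> p q z t ** conn_B \<theta> p q z t
        - conn_B \<theta> p q z t ** conn_A \<theta> p q z t)"
    by (rule operators_commute_on_iff_zero_curvature) (use A B \<open>open U\<close> in \<open>auto intro: open_Times\<close>)
  also have "\<dots> \<longleftrightarrow> (\<forall>z\<in>- {0}. \<forall>t\<in>U. A' z t = B_lin + conn_A \<theta> p q z t ** conn_B \<theta> p q z t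
        - conn_B \<theta> p q z t ** conn_A \<theta> p q z t)"
    by blast
  also have "\<dots> \<longleftrightarrow> (\<forall>z\<in>- {0 :: complex}. pq_system \<theta> U p q)"
    using pointwise by (simp add: pq_system_def)
  \<comment> \<open>The condition no longer involves z, and the punctured plane is nonempty, as z =
    1 shows.\<close>
  also have "\<dots> \<longleftrightarrow> pq_system \<theta> U p q"
    by (auto intro: exI[of _ 1])
  finally show ?thesis .
qed

theorem mainTheorem14:
  fixes \<theta> :: complex and U :: "complex set" and p q :: "complex \<Rightarrow> complex"
  assumes "open U" and "connected U" and "0 \<notin> U"
    and "p holomorphic_on U" and "q holomorphic_on U"
    and "\<And>t. t \<in> U \<Longrightarrow> q t \<noteq> 0"
  shows "(operators_commute_on ((- {0}) \<times> U) (conn_A \<theta> p q) (conn_B \<theta> p q)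
            \<longleftrightarrow> pq_system \<theta> U p q)
       \<and> (\<forall>P Q T. Q \<noteq> 0 \<longrightarrow> T \<noteq> 0 \<longrightarrow>
            - (Q ^ 2) * Ham_p \<theta> P Q T = 2 * P / T \<and>
            Q ^ 2 * Ham_q \<theta> P Q T =
              2 * P ^ 2 / (T * Q) + T * Q ^ 3 / 2 + (1 / 2) * (\<theta> + 1) * Q ^ 2 - 1 / T)
       \<and> (pq_system \<theta> U p q \<longleftrightarrow> hamiltonian_system \<theta> U p q)
       \<and> (pq_system \<theta> U p q \<longleftrightarrow>
            (\<forall>t\<in>U. p t = t / 2 * deriv q t) \<and> painleve_III_D7 \<theta> U q)"
proof (intro conjI allI impI)
  show "operators_commute_on ((- {0}) \<times> U) (conn_A \<theta> p q) (conn_B \<theta> p q) \<longleftrightarrow> pq_system \<theta> U p q"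
    using assms by (intro connection_commutes_iff_pq_system)
  show "pq_system \<theta> U p q \<longleftrightarrow> hamiltonian_system \<theta> U p q"
    unfolding pq_system_def hamiltonian_system_def
  proof (rule ball_cong[OF refl])
    fix t assume "t \<in> U"
    then have nz: "q t \<noteq> 0" "t \<noteq> 0"
      using assms by auto
    show "(deriv q t = 2 * p t / t \<and> deriv p t = 2 * (p t) ^ 2 / (t * q t) + t * (q t) ^ 3 / 2
          + (1 / 2) * (\<theta> + 1) * (q t) ^ 2 - 1 / t) \<longleftrightarrow>
        (deriv q t = - ((q t) ^ 2) * Ham_p \<theta> (p t) (q t) t \<and>
          deriv p t = (q t) ^ 2 * Ham_q \<theta> (p t) (q t) t)"
      unfolding hamiltonian_vector_field[OF nz] ..
  qed
  show "pq_system \<theta> U p q \<longleftrightarrow> (\<forall>t\<in>U. p t = t / 2 * deriv q t) \<and> painleve_III_D7 \<theta> U q"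
    using assms by (intro pq_system_iff_painleve)
qed (rule hamiltonian_vector_field, assumption+)+

end
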